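(* Let $[a,b]$ be a closed bounded interval, $n\ge2$ an integer, $h=(b-a)/n$, $x_k=a+kh$ ($0\le k\le n$), and let $N$ be a positive integer. For $1\le j\le N$ assume $\theta_j:[a,b]\to[a,b]$ is Lipschitz with $\mathrm{Lip}(\theta_j)\le c<1$ ($c$ independent of $j$), and $\beta_j\in K_{M_0}\setminus\{0\}\subset X_n$ with $M_0>0$ independent of $j$. Let $C_j$ be reals with $|C_j|\le C$, $C$ independent of $j$, and for a fixed $s\ge0$ define $\hat\beta_{j,s}\in X_n$ by $\hat\beta_{j,s}(x_k)=[1+\tfrac12C_jQ(\theta_j(x_k))][\beta_j(x_k)]^s$, $0\le k\le n$. Let $\delta>0$, define $L_{j,s}:X_n\to X_n$ by $(L_{j,s}\mathrm{w})(x_k)=\hat\beta_{j,s}(x_k)\,w^I(\theta_j(x_k))$ and $L_s=\sum_{j=1}^NL_{j,s}$. Assume $h\le1$ and $Ch/4\le1$; let $M_1=sM_0+(1+h)/2$ and $M_2=M_1+\delta$, and assume $\exp(-M_2h)\ge(1+c)/2$ and that $M\in\mathbb{R}$ satisfies $\exp(Mh)\ge2$. Then $L_s(K_M\setminus\{0\})\subset K_{M-\delta}\setminus\{0\}$.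
   Context: $X_n$ is the real vector space of maps $\mathrm{w}:\{x_0,\dots,x_n\}\to\mathbb{R}$, with $\mathrm{w}_j=\mathrm{w}(x_j)$. For $\mathrm{w}\in X_n$, $w^I:[a,b]\to\mathbb{R}$ is its piecewise linear interpolant: $w^I(x)=\frac{x-x_j}{h}\mathrm{w}_{j+1}+\frac{x_{j+1}-x}{h}\mathrm{w}_j$ for $x_j\le x\le x_{j+1}$, $0\le j<n$. For real $M$, $K_M=\{\mathrm{w}\in X_n:\mathrm{w}_{j+1}\le\mathrm{w}_je^{Mh}\text{ and }\mathrm{w}_j\le\mathrm{w}_{j+1}e^{Mh},\ 0\le j<n\}$. $Q:[a,b]\to[0,h^2/4]$ is $Q(u)=(x_{j+1}-u)(u-x_j)$ for $x_j\le u\le x_{j+1}$. *)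

theory Defs
  imports "HOL-Analysis.Analysis"
begin

definition step :: "real \<Rightarrow> real \<Rightarrow> nat \<Rightarrow> real" where
  "step a b n = (b - a) / real n"

definition node :: "real \<Rightarrow> real \<Rightarrow> nat \<Rightarrow> nat \<Rightarrow> real" where
  "node a b n k = a + real k * step a b n"

definition mesh :: "real \<Rightarrow> real \<Rightarrow> nat \<Rightarrow> real set" where
  "mesh a b n = node a b n ` {..n}"

text \<open>Mesh functions are extensional: outside the mesh they take the value \<^const>\<open>undefined\<close>,
  so that equality of mesh functions is equality of their nodal values.\<close>

definition X :: "real \<Rightarrow> real \<Rightarrow> nat \<Rightarrow> (real \<Rightarrow> real) set" where
  "X a b n = mesh a b n \<rightarrow>\<^sub>E UNIV"

definition zero_X :: "real \<Rightarrow> real \<Rightarrow> nat \<Rightarrow> real \<Rightarrow> real" where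
  "zero_X a b n = (\<lambda>x\<in>mesh a b n. 0)"

text \<open>The definite descriptions below are legitimate because the formulas of adjacent
  subintervals agree at the common node; see \<open>interp_eq\<close> and \<open>Q_eq\<close>.\<close>

definition interp :: "real \<Rightarrow> real \<Rightarrow> nat \<Rightarrow> (real \<Rightarrow> real) \<Rightarrow> real \<Rightarrow> real" where
  "interp a b n w = (\<lambda>u\<in>{a..b}. THE y. \<exists>j<n.
     node a b n j \<le> u \<and> u \<le> node a b n (j + 1) \<and>
     y = (u - node a b n j) / step a b n * w (node a b n (j + 1)) +
         (node a b n (j + 1) - u) / step a b n * w (node a b n j))"

definition Q :: "real \<Rightarrow> real \<Rightarrow> nat \<Rightarrow> real \<Rightarrow> real" where
  "Q a b n = (\<lambda>u\<in>{a..b}. THE y. \<exists>j<n.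
     node a b n j \<le> u \<and> u \<le> node a b n (j + 1) \<and>
     y = (node a b n (j + 1) - u) * (u - node a b n j))"

definition K :: "real \<Rightarrow> real \<Rightarrow> nat \<Rightarrow> real \<Rightarrow> (real \<Rightarrow> real) set" where
  "K a b n M = {w \<in> X a b n. \<forall>j<n.
     w (node a b n (j + 1)) \<le> w (node a b n j) * exp (M * step a b n) \<and>
     w (node a b n j) \<le> w (node a b n (j + 1)) * exp (M * step a b n)}"

text \<open>The weight is only used with \<open>\<beta>\<close> a nonzero element of \<open>K a b n M\<^sub>0\<close>, \<open>M\<^sub>0 > 0\<close>, whose nodal
  values are all positive; so \<open>powr\<close> is the ordinary real power (and \<open>\<beta> x powr 0 = 1\<close>).\<close>

definition beta_hat ::
  "real \<Rightarrow> real \<Rightarrow> nat \<Rightarrow> (real \<Rightarrow> real) \<Rightarrow> (real \<Rightarrow> real) \<Rightarrow> real \<Rightarrow> real \<Rightarrow> real \<Rightarrow> real" where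
  "beta_hat a b n \<theta> \<beta> C s =
     (\<lambda>x\<in>mesh a b n. (1 + 1 / 2 * C * Q a b n (\<theta> x)) * \<beta> x powr s)"

definition L_single ::
  "real \<Rightarrow> real \<Rightarrow> nat \<Rightarrow> (real \<Rightarrow> real) \<Rightarrow> (real \<Rightarrow> real) \<Rightarrow> real \<Rightarrow> real \<Rightarrow>
   (real \<Rightarrow> real) \<Rightarrow> real \<Rightarrow> real" where
  "L_single a b n \<theta> \<beta> C s w =
     (\<lambda>x\<in>mesh a b n. beta_hat a b n \<theta> \<beta> C s x * interp a b n w (\<theta> x))"

definition L ::
  "real \<Rightarrow> real \<Rightarrow> nat \<Rightarrow> nat \<Rightarrow> (nat \<Rightarrow> real \<Rightarrow> real) \<Rightarrow> (nat \<Rightarrow> real \<Rightarrow> real) \<Rightarrow> (nat \<Rightarrow> real) \<Rightarrow>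
   real \<Rightarrow> (real \<Rightarrow> real) \<Rightarrow> real \<Rightarrow> real" where
  "L a b n N \<theta> \<beta> C s w =
     (\<lambda>x\<in>mesh a b n. \<Sum>j=1..N. L_single a b n (\<theta> j) (\<beta> j) (C j) s w x)"

lemma step_pos: "a < b \<Longrightarrow> 0 < n \<Longrightarrow> 0 < step a b n"
  by (simp add: step_def)

lemma node_Suc: "node a b n (Suc j) = node a b n j + step a b n"
  by (simp add: node_def algebra_simps)

lemma node_mono: "a < b \<Longrightarrow> 0 < n \<Longrightarrow> i \<le> j \<Longrightarrow> node a b n i \<le> node a b n j"
  using step_pos[of a b n] by (simp add: node_def mult_right_mono)

lemma node_last: "0 < n \<Longrightarrow> node a b n n = b"
  by (simp add: node_def step_def)

lemma node_interval:
  assumes "a < b" "j < n" "node a b n j \<le> u" "u \<le> node a b n (j + 1)"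
  shows "u \<in> {a..b}"
proof -
  have "node a b n 0 \<le> node a b n j" "node a b n (j + 1) \<le> node a b n n"
    using assms by (auto intro!: node_mono)
  moreover have "node a b n 0 = a" "node a b n n = b"
    using assms node_last[of n a b] by (simp_all add: node_def)
  ultimately show ?thesis
    using assms(3,4) by simp
qed

lemma node_overlap:
  assumes "a < b" "0 < n"
    and "node a b n i \<le> u" "u \<le> node a b n (i + 1)"
    and "node a b n j \<le> u" "u \<le> node a b n (j + 1)"
  shows "i = j \<or> (j = i + 1 \<and> u = node a b n j) \<or> (i = j + 1 \<and> u = node a b n i)"
proof -
  have aux: "l = k + 1 \<and> u = node a b n l"
    if "k < l" "u \<le> node a b n (k + 1)" "node a b n l \<le> u" for k l
  proof -
    have "node a b n (k + 1) \<le> node a b n l"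
      using node_mono assms(1,2) that(1) by simp
    then have eq: "node a b n (k + 1) = node a b n l" "u = node a b n l"
      using that by linarith+
    then have "real (k + 1) = real l"
      using step_pos[OF assms(1,2)] by (simp add: node_def del: of_nat_add)
    then show ?thesis
      using eq(2) by linarith
  qed
  consider "i < j" | "i = j" | "j < i"
    by linarith
  then show ?thesis
    by cases (use aux[of i j] aux[of j i] assms(3-6) in blast)+
qed

lemma interp_eq:
  assumes "a < b" "j < n" and u: "node a b n j \<le> u" "u \<le> node a b n (j + 1)"
  shows "interp a b n w u =
    (u - node a b n j) / step a b n * w (node a b n (j + 1)) +
    (node a b n (j + 1) - u) / step a b n * w (node a b n j)"
proof -
  have n: "0 < n" using assms by simp
  have h: "step a b n \<noteq> 0" using step_pos[OF assms(1) n] by simp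
  define F where "F i = (u - node a b n i) / step a b n * w (node a b n (i + 1)) +
    (node a b n (i + 1) - u) / step a b n * w (node a b n i)" for i
  have F: "F i = F j" if "node a b n i \<le> u" "u \<le> node a b n (i + 1)" for i
    using node_overlap[OF assms(1) n that u]
  proof (elim disjE conjE)
    assume "j = i + 1" "u = node a b n j"
    then show ?thesis using h by (simp add: F_def node_Suc)
  next
    assume "i = j + 1" "u = node a b n i"
    then show ?thesis using h by (simp add: F_def node_Suc)
  qed simp
  have "(THE y. \<exists>i<n. node a b n i \<le> u \<and> u \<le> node a b n (i + 1) \<and> y = F i) = F j"
  proof (rule the_equality)
    show "\<exists>i<n. node a b n i \<le> u \<and> u \<le> node a b n (i + 1) \<and> F j = F i"
      using assms by blast
  qed (use F in blast)
  then show ?thesis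
    using node_interval[OF assms] by (simp only: interp_def restrict_apply F_def if_True)
qed

lemma Q_eq:
  assumes "a < b" "j < n" and u: "node a b n j \<le> u" "u \<le> node a b n (j + 1)"
  shows "Q a b n u = (node a b n (j + 1) - u) * (u - node a b n j)"
proof -
  have n: "0 < n" using assms by simp
  define F where "F i = (node a b n (i + 1) - u) * (u - node a b n i)" for i
  have F: "F i = F j" if "node a b n i \<le> u" "u \<le> node a b n (i + 1)" for i
    using node_overlap[OF assms(1) n that u]
  proof (elim disjE conjE)
    assume "j = i + 1" "u = node a b n j"
    then show ?thesis by (simp add: F_def)
  next
    assume "i = j + 1" "u = node a b n i"
    then show ?thesis by (simp add: F_def)
  qed simp
  have "(THE y. \<exists>i<n. node a b n i \<le> u \<and> u \<le> node a b n (i + 1) \<and> y = F i) = F j"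
  proof (rule the_equality)
    show "\<exists>i<n. node a b n i \<le> u \<and> u \<le> node a b n (i + 1) \<and> F j = F i"
      using assms by blast
  qed (use F in blast)
  then show ?thesis
    using node_interval[OF assms] by (simp only: Q_def restrict_apply F_def if_True)
qed

end

theory Submission
  imports Defs
begin

text \<open>All nodal values of a nonzero element of \<open>K\<^sub>M\<close> are positive, so it is enough to compare each
  of the \<open>N\<close> summands at two adjacent nodes. The factor \<open>\<beta>\<^sup>s\<close> changes by at most \<open>exp (s M\<^sub>0 h)\<close> and
  the factor \<open>1 + C Q / 2\<close> by at most \<open>exp (h (1 + h) / 2)\<close>, which together give \<open>exp (M\<^sub>1 h)\<close>.
  A contraction \<open>\<theta>\<close> brings the two nodes to distance at most \<open>c h\<close>, less than one mesh width, so only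
  the at most three surrounding nodal values enter, and the interpolant changes by at most the factor
  \<open>exp (M h) (1 + c) / 2 \<le> exp ((M - M\<^sub>2) h)\<close>. The product of the factors is \<open>exp ((M - \<delta>) h)\<close>.\<close>

section \<open>Mesh, local coordinates and bounds on \<open>Q\<close>\<close>

lemma node_0: "node a b n 0 = a"
  by (simp add: node_def)

lemma node_in_interval:
  assumes "a < b" "0 < n" "k \<le> n"
  shows "node a b n k \<in> {a..b}"
  using node_mono[OF assms(1,2), of 0 k] node_mono[OF assms(1-3)] node_last[OF assms(2)]
  by (simp add: node_0)

lemma node_in_mesh: "k \<le> n \<Longrightarrow> node a b n k \<in> mesh a b n"
  by (simp add: mesh_def)

lemma mesh_subset: "a < b \<Longrightarrow> 0 < n \<Longrightarrow> mesh a b n \<subseteq> {a..b}"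
  using node_in_interval unfolding mesh_def by blast

lemma subinterval_exists:
  assumes "a < b" "0 < n" "u \<in> {a..b}"
  obtains j where "j < n" "node a b n j \<le> u" "u \<le> node a b n (j + 1)"
proof -
  \<comment> \<open>With the least index, \<open>node a b n j \<le> u\<close> comes from
    \<open>a \<le> u\<close> if \<open>j = 0\<close> and from minimality at the predecessor
    otherwise.\<close>
  define j where "j = (LEAST j. u \<le> node a b n (j + 1))"
  have n: "u \<le> node a b n ((n - 1) + 1)"
    using assms node_last by simp
  have u: "u \<le> node a b n (j + 1)"
    unfolding j_def by (rule LeastI[of "\<lambda>j. u \<le> node a b n (j + 1)", OF n])
  have "j \<le> n - 1"
    unfolding j_def by (rule Least_le[of "\<lambda>j. u \<le> node a b n (j + 1)", OF n])
  then have "j < n" using assms(2) by linarith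
  moreover have "node a b n j \<le> u"
  proof (cases j)
    case 0
    then show ?thesis using assms by (simp add: node_0)
  next
    case (Suc i)
    then have "\<not> u \<le> node a b n (i + 1)"
      using not_less_Least[of i "\<lambda>j. u \<le> node a b n (j + 1)"] by (simp add: j_def)
    then show ?thesis using Suc by simp
  qed
  ultimately show ?thesis using that u by blast
qed

lemma subinterval_coordinate:
  assumes "a < b" "0 < n" "u \<in> {a..b}"
  obtains j t where "j < n" "0 \<le> t" "t \<le> 1" "u = node a b n j + t * step a b n"
proof -
  obtain j where j: "j < n" "node a b n j \<le> u" "u \<le> node a b n (j + 1)"
    using subinterval_exists[OF assms] .
  have "0 < step a b n" using step_pos assms by simp
  with j show ?thesis
    by (intro that[of j "(u - node a b n j) / step a b n"]) (simp_all add: node_Suc field_simps)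
qed

lemma interp_coordinate:
  assumes "a < b" "j < n" "0 \<le> t" "t \<le> 1"
  shows "interp a b n w (node a b n j + t * step a b n) =
    (1 - t) * w (node a b n j) + t * w (node a b n (j + 1))"
proof -
  have h: "0 < step a b n" using step_pos assms by simp
  have "t * step a b n \<le> step a b n" using h assms by (simp add: mult_left_le_one_le)
  then show ?thesis
    using h assms by (subst interp_eq[of a b j n]) (simp_all add: node_Suc field_simps)
qed

lemma Q_bounds:
  assumes "a < b" "0 < n" "u \<in> {a..b}"
  shows "0 \<le> Q a b n u" "Q a b n u \<le> (step a b n)\<^sup>2 / 4"
proof -
  obtain j where j: "j < n" "node a b n j \<le> u" "u \<le> node a b n (j + 1)"
    using subinterval_exists[OF assms] .
  have Q: "Q a b n u = (node a b n (j + 1) - u) * (u - node a b n j)"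
    using Q_eq[OF assms(1) j] .
  show "0 \<le> Q a b n u" using j unfolding Q by simp
  have "(step a b n)\<^sup>2 / 4 - Q a b n u = (u - node a b n j - step a b n / 2)\<^sup>2"
    unfolding Q by (simp add: node_Suc power2_eq_square field_simps)
  then show "Q a b n u \<le> (step a b n)\<^sup>2 / 4"
    by (metis diff_ge_0_iff_ge zero_le_power2)
qed

section \<open>Positivity on the cone\<close>

lemma zero_X_in_X: "zero_X a b n \<in> X a b n"
  by (simp add: zero_X_def X_def)

lemma K_stepD:
  assumes "w \<in> K a b n M" "j < n"
  shows "w (node a b n (j + 1)) \<le> w (node a b n j) * exp (M * step a b n)"
    and "w (node a b n j) \<le> w (node a b n (j + 1)) * exp (M * step a b n)"
  using assms by (auto simp: K_def)

text \<open>Chaining the two inequalities at a pair of neighbours gives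
  \<open>y \<le> y * E * E\<close>, impossible for negative \<open>y\<close> because
  \<open>E > 1\<close>. A zero then spreads to both neighbours and so to the whole mesh, which is
  excluded for a nonzero \<open>w\<close>.\<close>

lemma K_pos:
  assumes n: "0 < n" and E: "1 < exp (M * step a b n)"
    and w: "w \<in> K a b n M - {zero_X a b n}" and x: "x \<in> mesh a b n"
  shows "0 < w x"
proof -
  let ?E = "exp (M * step a b n)"
  let ?w = "\<lambda>j. w (node a b n j)"
  have wK: "w \<in> K a b n M" using w by simp
  have nonneg_step: "0 \<le> ?w j \<and> 0 \<le> ?w (j + 1)" if "j < n" for j
  proof -
    have *: "0 \<le> y" if "z \<le> y * ?E" "y \<le> z * ?E" for y z :: real
    proof (rule ccontr)
      assume "\<not> 0 \<le> y"
      have "y \<le> (y * ?E) * ?E" using that by (meson exp_ge_zero mult_right_mono order_trans)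
      moreover have "1 < ?E * ?E" using E by (simp add: less_1_mult)
      then have "y * (?E * ?E) < y * 1" using \<open>\<not> 0 \<le> y\<close> by (intro mult_strict_left_mono_neg) auto
      ultimately show False by (simp add: mult.assoc)
    qed
    show ?thesis using *[of "?w (j + 1)" "?w j"] *[of "?w j" "?w (j + 1)"] K_stepD[OF wK that] by blast
  qed
  \<comment> \<open>The last node starts no subinterval; its value is the right end of the one with
    index \<open>n - 1\<close>.\<close>
  have nonneg: "0 \<le> ?w j" if "j \<le> n" for j
    using nonneg_step[of j] nonneg_step[of "n - 1"] that n by (cases "j < n") auto
  have zero_iff: "?w (Suc j) = 0 \<longleftrightarrow> ?w j = 0" if "j < n" for j
    using K_stepD[OF wK that] nonneg[of j] nonneg[of "Suc j"] that by auto
  have zero_0: "?w j = 0 \<longleftrightarrow> ?w 0 = 0" if "j \<le> n" for j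
    using that by (induction j) (auto simp: zero_iff)
  have "w \<in> X a b n" using wK by (simp add: K_def)
  have "?w 0 \<noteq> 0"
  proof
    assume "?w 0 = 0"
    then have "?w j = 0" if "j \<le> n" for j
      using zero_0[OF that] by blast
    then have "w y = zero_X a b n y" if "y \<in> mesh a b n" for y
      using that by (auto simp: mesh_def zero_X_def)
    then have "w = zero_X a b n"
      using PiE_ext[OF \<open>w \<in> X a b n\<close>[unfolded X_def] zero_X_in_X[unfolded X_def]] by blast
    then show False using w by simp
  qed
  then have "0 < ?w j" if "j \<le> n" for j
    using zero_0[OF that] nonneg[OF that] by linarith
  then show ?thesis using x by (auto simp: mesh_def)
qed

lemma interp_pos:
  assumes "a < b" "0 < n" "u \<in> {a..b}" and pos: "\<And>x. x \<in> mesh a b n \<Longrightarrow> 0 < w x"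
  shows "0 < interp a b n w u"
proof -
  obtain j t where j: "j < n" "0 \<le> t" "t \<le> 1" "u = node a b n j + t * step a b n"
    using subinterval_coordinate[OF assms(1-3)] .
  have "0 < w (node a b n j)" "0 < w (node a b n (j + 1))"
    using j(1) by (auto intro!: pos node_in_mesh)
  then have "0 < (1 - t) * w (node a b n j) + t * w (node a b n (j + 1))"
    using j by (cases "t = 0") (auto intro!: add_nonneg_pos)
  then show ?thesis using interp_coordinate[OF assms(1) j(1-3)] j by simp
qed

section \<open>Comparing the interpolant at nearby points\<close>

text \<open>The case of two points in one subinterval. Their values differ by
  \<open>(p - q) * (w1 - w0)\<close>, and the nodal values differ by at most \<open>E - 1\<close>
  times the smaller one, which is at most \<open>v\<close>. The resulting factor
  \<open>1 + c * (E - 1)\<close> is at most \<open>E * ((1 + c) / 2)\<close> because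
  \<open>(1 - c) * (E - 2) \<ge> 0\<close>; hence the condition \<open>2 \<le> E\<close>.\<close>

lemma convex_combination_ratio:
  fixes p q c E w0 w1 :: real
  assumes p: "0 \<le> p" "p \<le> 1" and q: "0 \<le> q" "q \<le> 1" and "\<bar>p - q\<bar> \<le> c" "c < 1" "2 \<le> E"
    and w: "0 < w0" "0 < w1" "w1 \<le> w0 * E" "w0 \<le> w1 * E"
  shows "(1 - p) * w0 + p * w1 \<le> E * ((1 + c) / 2) * ((1 - q) * w0 + q * w1)"
proof -
  define m where "m = min w0 w1"
  define v where "v = (1 - q) * w0 + q * w1"
  have "\<bar>w1 - w0\<bar> \<le> (E - 1) * m"
    using w by (auto simp: m_def min_def algebra_simps)
  then have "\<bar>p - q\<bar> * \<bar>w1 - w0\<bar> \<le> c * ((E - 1) * m)"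
    using assms by (intro mult_mono) auto
  then have "(p - q) * (w1 - w0) \<le> c * ((E - 1) * m)"
    by (metis abs_ge_self abs_mult order_trans)
  moreover have m: "m \<le> v"
  proof -
    have "(1 - q) * m + q * m \<le> v"
      unfolding v_def m_def using q by (intro add_mono mult_left_mono) auto
    then show ?thesis by (simp add: algebra_simps)
  qed
  then have "c * ((E - 1) * m) \<le> c * ((E - 1) * v)"
    using assms by (intro mult_left_mono) auto
  ultimately have "v + (p - q) * (w1 - w0) \<le> (1 + c * (E - 1)) * v"
    by (simp add: algebra_simps)
  also have "\<dots> \<le> E * ((1 + c) / 2) * v"
  proof (rule mult_right_mono)
    have "0 \<le> (1 - c) * (E - 2)" using assms by simp
    then show "1 + c * (E - 1) \<le> E * ((1 + c) / 2)" by (simp add: field_simps)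
    show "0 \<le> v" using m w by (simp add: m_def)
  qed
  finally show ?thesis by (simp add: v_def algebra_simps)
qed

text \<open>Here \<open>w0, w1, w2\<close> are the values at three consecutive nodes and the two points lie on different
  sides of the middle one, at distances \<open>q h\<close> and \<open>p h\<close>. With extremal \<open>w0 = w1 / E\<close> and
  \<open>w2 = w1 E\<close>, and \<open>c = p + q\<close>, twice the difference of the two sides is \<open>w1\<close> times an affine
  function of \<open>E\<close> with slope \<open>1 - p - q (p + q) \<ge> 0\<close> and value \<open>q (1 - p - q) \<ge> 0\<close> at \<open>E = 2\<close>.\<close>

lemma adjacent_ratio:
  fixes p q c E w0 w1 w2 :: real
  assumes p: "0 \<le> p" and q: "0 \<le> q" and pq: "p + q \<le> c" and "c < 1" and E: "2 \<le> E"
    and w1: "0 < w1" "w2 \<le> w1 * E" "w1 \<le> w0 * E"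
  shows "(1 - p) * w1 + p * w2 \<le> E * ((1 + c) / 2) * ((1 - q) * w1 + q * w0)"
proof -
  have "p + q < 1" using assms by linarith
  have "(1 - p) * w1 + p * w2 \<le> (1 - p) * w1 + p * (w1 * E)"
    using p w1 by (intro add_left_mono mult_left_mono) auto
  also have "\<dots> = (1 + p * (E - 1)) * w1" by (simp add: algebra_simps)
  also have "\<dots> \<le> (1 + c) / 2 * (E - q * (E - 1)) * w1"
  proof (rule mult_right_mono)
    have "q * (p + q) \<le> q * 1" using \<open>p + q < 1\<close> q by (intro mult_left_mono) auto
    then have "0 \<le> (1 - p - q * (p + q)) * (E - 2)" "0 \<le> q * (1 - p - q)"
      using \<open>p + q < 1\<close> E q by auto
    then have "1 + p * (E - 1) \<le> (1 + (p + q)) / 2 * (E - q * (E - 1))"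
      by (simp add: field_simps)
    also have "\<dots> \<le> (1 + c) / 2 * (E - q * (E - 1))"
    proof (rule mult_right_mono)
      have "q * (E - 1) \<le> 1 * (E - 1)" using E p \<open>p + q < 1\<close> by (intro mult_right_mono) auto
      then show "0 \<le> E - q * (E - 1)" by simp
    qed (use pq in simp)
    finally show "1 + p * (E - 1) \<le> (1 + c) / 2 * (E - q * (E - 1))" .
  qed (use w1 in simp)
  also have "\<dots> = (1 + c) / 2 * (E * (1 - q) * w1 + q * w1)" by (simp add: field_simps)
  also have "\<dots> \<le> (1 + c) / 2 * (E * (1 - q) * w1 + q * (w0 * E))"
    using assms by (intro mult_left_mono add_left_mono) auto
  also have "\<dots> = E * ((1 + c) / 2) * ((1 - q) * w1 + q * w0)" by (simp add: field_simps)
  finally show ?thesis .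
qed

lemma interp_ratio:
  assumes ab: "a < b" "0 < n" and c: "c < 1" and E: "2 \<le> exp (M * step a b n)"
    and w: "w \<in> K a b n M - {zero_X a b n}"
    and u: "u \<in> {a..b}" and v: "v \<in> {a..b}" and uv: "\<bar>u - v\<bar> \<le> c * step a b n"
  shows "interp a b n w u \<le> exp (M * step a b n) * ((1 + c) / 2) * interp a b n w v"
proof -
  define h where "h = step a b n"
  define E where "E = exp (M * step a b n)"
  have h: "0 < h" using step_pos ab by (simp add: h_def)
  have E2: "2 \<le> E" using assms by (simp add: E_def)
  obtain i p where i: "i < n" and p: "0 \<le> p" "p \<le> 1" and ui: "u = node a b n i + p * h"
    using subinterval_coordinate[OF ab u] unfolding h_def .
  obtain j q where j: "j < n" and q: "0 \<le> q" "q \<le> 1" and vj: "v = node a b n j + q * h"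
    using subinterval_coordinate[OF ab v] unfolding h_def .
  have pos: "0 < w (node a b n k)" if "k \<le> n" for k
    using K_pos[OF ab(2) less_le_trans[OF _ E] w node_in_mesh[OF that]] by simp
  have stepD: "w (node a b n (k + 1)) \<le> w (node a b n k) * E"
      "w (node a b n k) \<le> w (node a b n (k + 1)) * E" if "k < n" for k
    using K_stepD[of w a b n M k] w that by (auto simp: E_def)
  have Iu: "interp a b n w u = (1 - p) * w (node a b n i) + p * w (node a b n (i + 1))"
    using interp_coordinate[OF ab(1) i p] by (simp add: ui h_def)
  have Iv: "interp a b n w v = (1 - q) * w (node a b n j) + q * w (node a b n (j + 1))"
    using interp_coordinate[OF ab(1) j q] by (simp add: vj h_def)
  have "u - v = (real i + p - (real j + q)) * h"
    by (simp add: ui vj node_def h_def algebra_simps)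
  then have "\<bar>real i + p - (real j + q)\<bar> * h \<le> c * h"
    using uv h by (simp add: abs_mult h_def)
  then have d: "\<bar>real i + p - (real j + q)\<bar> \<le> c" using h by simp
  consider "i = j" | "i = j + 1" | "j = i + 1"
  proof -
    have "real i < real j + 2" "real j < real i + 2" using d c p q by linarith+
    then have "i < j + 2" "j < i + 2" by linarith+
    then show ?thesis using that by linarith
  qed
  then have "interp a b n w u \<le> E * ((1 + c) / 2) * interp a b n w v"
  proof cases
    case 1
    then show ?thesis unfolding Iu Iv
      using convex_combination_ratio[OF p q _ c E2] d pos[of j] pos[of "j + 1"] stepD[OF j] j
      by simp
  next
    case 2
    \<comment> \<open>The middle node is number \<open>i = j + 1\<close>; \<open>v\<close> lies
      \<open>(1 - q) * h\<close> to its left and \<open>u\<close> lies \<open>p * h\<close> to its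
      right.\<close>
    then have pq: "p + (1 - q) \<le> c" using d by simp
    have "0 < w (node a b n i)" "w (node a b n i) \<le> w (node a b n j) * E"
      using pos i stepD(1)[OF j] 2 by simp_all
    from adjacent_ratio[OF p(1) _ pq c E2 this(1) stepD(1)[OF i] this(2)]
    show ?thesis unfolding Iu Iv using q 2 by (simp add: add.commute)
  next
    case 3
    \<comment> \<open>The mirror image: the middle node is number \<open>j = i + 1\<close>, with
      \<open>u\<close> on its left, so the three nodal values enter \<open>adjacent_ratio\<close>
      from right to left.\<close>
    then have pq: "(1 - p) + q \<le> c" using d by simp
    have "0 < w (node a b n j)" "w (node a b n i) \<le> w (node a b n j) * E"
      using pos j stepD(2)[OF i] 3 by simp_all
    from adjacent_ratio[OF _ q(1) pq c E2 this stepD(2)[OF j]]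
    show ?thesis unfolding Iu Iv using p 3 by (simp add: add.commute)
  qed
  then show ?thesis by (simp add: E_def)
qed

section \<open>Comparing the weights at adjacent nodes\<close>

text \<open>The bound on \<open>C\<close> absorbs one factor \<open>h\<close> of
  \<open>Q \<le> h^2 / 4\<close>. For \<open>h \<le> 1\<close> the correction is then at most 1/2 in
  absolute value, which keeps the weights positive.\<close>

lemma half_mult_Q_bound:
  assumes ab: "a < b" "0 < n" and C: "\<bar>C\<bar> * step a b n / 4 \<le> 1" and u: "u \<in> {a..b}"
  shows "\<bar>1 / 2 * C * Q a b n u\<bar> \<le> step a b n / 2"
proof -
  have h: "0 < step a b n" using step_pos ab by simp
  have "\<bar>1 / 2 * C * Q a b n u\<bar> = 1 / 2 * \<bar>C\<bar> * Q a b n u"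
    using Q_bounds[OF ab u] by (simp add: abs_mult)
  also have "\<dots> \<le> 1 / 2 * \<bar>C\<bar> * ((step a b n)\<^sup>2 / 4)"
    using Q_bounds[OF ab u] by (intro mult_left_mono) auto
  also have "\<dots> = (\<bar>C\<bar> * step a b n / 4) * (step a b n / 2)"
    by (simp add: power2_eq_square)
  also have "\<dots> \<le> 1 * (step a b n / 2)"
    using C h by (intro mult_right_mono) auto
  finally show ?thesis by simp
qed

text \<open>Since \<open>Q \<ge> 0\<close>, the two corrections \<open>C Q / 2\<close> have the same sign; this is what keeps the ratio below
  \<open>max (1 + h / 2) (1 / (1 - h / 2))\<close>.\<close>

lemma correction_ratio:
  assumes ab: "a < b" "0 < n" and h1: "step a b n \<le> 1" and C: "\<bar>C\<bar> * step a b n / 4 \<le> 1"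
    and u: "u \<in> {a..b}" and v: "v \<in> {a..b}"
  shows "1 + 1 / 2 * C * Q a b n u
    \<le> exp ((1 + step a b n) / 2 * step a b n) * (1 + 1 / 2 * C * Q a b n v)"
proof -
  define h where "h = step a b n"
  define A where "A = 1 / 2 * C * Q a b n u"
  define B where "B = 1 / 2 * C * Q a b n v"
  define e where "e = (1 + h) / 2 * h"
  have h: "0 < h" "h \<le> 1" using step_pos ab h1 by (simp_all add: h_def)
  have AB: "\<bar>A\<bar> \<le> h / 2" "\<bar>B\<bar> \<le> h / 2"
    using half_mult_Q_bound[OF ab C] u v by (simp_all add: A_def B_def h_def)
  \<comment> \<open>With \<open>t = h / 2\<close> this is the \<open>t + 2 * t^2\<close> of the
    estimate \<open>ln (1 - t) \<ge> - t - 2 * t^2\<close> for \<open>0 \<le> t \<le> 1/2\<close>.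
    It explains the term \<open>(1 + h) / 2\<close> in \<open>M1\<close>.\<close>
  have e: "e = h / 2 + 2 * (h / 2)\<^sup>2" by (simp add: e_def power2_eq_square field_simps)
  have "1 + A \<le> exp e * (1 + B)"
  proof (cases "0 \<le> C")
    case True
    then have "0 \<le> B" using Q_bounds[OF ab v] by (simp add: B_def)
    have "1 + A \<le> 1 + h / 2" using AB by simp
    also have "\<dots> \<le> 1 + e" by (simp add: e)
    also have "\<dots> \<le> exp e" by (rule exp_ge_add_one_self)
    also have "\<dots> \<le> exp e * (1 + B)" using \<open>0 \<le> B\<close> by simp
    finally show ?thesis .
  next
    case False
    then have "A \<le> 0" using Q_bounds[OF ab u] by (simp add: A_def mult_nonpos_nonneg)
    have "- e \<le> ln (1 - h / 2)"
      using ln_one_minus_pos_lower_bound[of "h / 2"] h by (simp add: e)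
    then have "exp (- e) \<le> 1 - h / 2" using h by (subst (asm) ln_ge_iff) auto
    also have "\<dots> \<le> 1 + B" using AB by simp
    finally have "exp e * exp (- e) \<le> exp e * (1 + B)" by simp
    then show ?thesis using \<open>A \<le> 0\<close> by (simp add: exp_minus)
  qed
  then show ?thesis by (simp add: A_def B_def e_def h_def)
qed

lemma beta_hat_pos:
  assumes ab: "a < b" "0 < n" and h1: "step a b n \<le> 1" and C: "\<bar>C\<bar> * step a b n / 4 \<le> 1"
    and x: "x \<in> mesh a b n" and \<theta>: "\<theta> x \<in> {a..b}" and pos: "0 < \<beta> x"
  shows "0 < beta_hat a b n \<theta> \<beta> C s x"
proof -
  have "0 < 1 + 1 / 2 * C * Q a b n (\<theta> x)"
    using half_mult_Q_bound[OF ab C \<theta>] h1 by linarith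
  moreover have "0 < \<beta> x powr s" using pos by simp
  ultimately show ?thesis using x unfolding beta_hat_def restrict_apply by simp
qed

lemma beta_hat_ratio:
  assumes ab: "a < b" "0 < n" and h1: "step a b n \<le> 1" and C: "\<bar>C\<bar> * step a b n / 4 \<le> 1"
    and s: "0 \<le> s" and x: "x \<in> mesh a b n" and y: "y \<in> mesh a b n"
    and \<theta>: "\<theta> x \<in> {a..b}" "\<theta> y \<in> {a..b}" and pos: "0 < \<beta> x" "0 < \<beta> y"
    and le: "\<beta> x \<le> \<beta> y * exp (M0 * step a b n)"
  shows "beta_hat a b n \<theta> \<beta> C s x
    \<le> exp ((s * M0 + (1 + step a b n) / 2) * step a b n) * beta_hat a b n \<theta> \<beta> C s y"
proof -
  define h where "h = step a b n"
  have "\<beta> x powr s \<le> (\<beta> y * exp (M0 * h)) powr s"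
    using pos le s by (intro powr_mono2) (auto simp: h_def)
  also have "\<dots> = exp (s * M0 * h) * \<beta> y powr s"
    using pos by (simp add: powr_def ln_mult exp_add[symmetric] algebra_simps)
  finally have \<beta>: "\<beta> x powr s \<le> exp (s * M0 * h) * \<beta> y powr s" .
  have "0 < 1 + 1 / 2 * C * Q a b n (\<theta> y)"
    using half_mult_Q_bound[OF ab C \<theta>(2)] h1 by linarith
  then have "(1 + 1 / 2 * C * Q a b n (\<theta> x)) * \<beta> x powr s
    \<le> (exp ((1 + h) / 2 * h) * (1 + 1 / 2 * C * Q a b n (\<theta> y))) * (exp (s * M0 * h) * \<beta> y powr s)"
    using correction_ratio[OF ab h1 C \<theta>] \<beta> unfolding h_def
    by (intro mult_mono mult_nonneg_nonneg) auto
  also have "\<dots> = exp ((s * M0 + (1 + h) / 2) * h)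
      * ((1 + 1 / 2 * C * Q a b n (\<theta> y)) * \<beta> y powr s)"
    unfolding distrib_right[of "s * M0"] exp_add by (simp only: mult_ac)
  finally show ?thesis
    using x y by (simp only: beta_hat_def restrict_apply if_True h_def)
qed

section \<open>Summation over the branches\<close>

lemma L_node:
  assumes "x \<in> mesh a b n"
  shows "L a b n N \<theta> \<beta> C s w x =
    (\<Sum>j=1..N. beta_hat a b n (\<theta> j) (\<beta> j) (C j) s x * interp a b n w (\<theta> j x))"
  using assms by (simp add: L_def L_single_def)

theorem theorem7p3:
  fixes a b h c M0 Cb s \<delta> M1 M2 M :: real
    and n N :: nat
    and \<theta> \<beta> :: "nat \<Rightarrow> real \<Rightarrow> real"
    and C :: "nat \<Rightarrow> real"
  assumes "a < b" and "n \<ge> 2" and "h = step a b n" and "N \<ge> 1"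
    and "c < 1"
    and "\<And>j. j \<in> {1..N} \<Longrightarrow> \<theta> j \<in> {a..b} \<rightarrow> {a..b}"
    and "\<And>j. j \<in> {1..N} \<Longrightarrow> c-lipschitz_on {a..b} (\<theta> j)"
    and "M0 > 0"
    and "\<And>j. j \<in> {1..N} \<Longrightarrow> \<beta> j \<in> K a b n M0 - {zero_X a b n}"
    and "\<And>j. j \<in> {1..N} \<Longrightarrow> \<bar>C j\<bar> \<le> Cb"
    and "s \<ge> 0" and "\<delta> > 0"
    and "h \<le> 1" and "Cb * h / 4 \<le> 1"
    and "M1 = s * M0 + (1 + h) / 2" and "M2 = M1 + \<delta>"
    and "exp (- M2 * h) \<ge> (1 + c) / 2"
    and "exp (M * h) \<ge> 2"
  shows "L a b n N \<theta> \<beta> C s ` (K a b n M - {zero_X a b n})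
           \<subseteq> K a b n (M - \<delta>) - {zero_X a b n}"
proof (rule image_subsetI)
  fix w assume w: "w \<in> K a b n M - {zero_X a b n}"
  let ?L = "L a b n N \<theta> \<beta> C s w"
  define T where "T j x = beta_hat a b n (\<theta> j) (\<beta> j) (C j) s x * interp a b n w (\<theta> j x)" for j x
  note h = \<open>h = step a b n\<close>
  have ab: "a < b" "0 < n" using assms by auto
  have h0: "0 < h" "step a b n \<le> 1" using step_pos[OF ab] assms by auto
  have E: "2 \<le> exp (M * step a b n)" using assms by simp
  have C: "\<bar>C j\<bar> * step a b n / 4 \<le> 1" if "j \<in> {1..N}" for j
  proof -
    have "\<bar>C j\<bar> * h \<le> Cb * h" using assms(10)[OF that] h0 by (intro mult_right_mono) auto
    then show ?thesis using \<open>Cb * h / 4 \<le> 1\<close> h by simp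
  qed
  have \<theta>: "\<theta> j x \<in> {a..b}" if "j \<in> {1..N}" "x \<in> mesh a b n" for j x
    using assms(6)[OF that(1)] mesh_subset[OF ab] that(2) by blast
  have \<beta>: "0 < \<beta> j x" if "j \<in> {1..N}" "x \<in> mesh a b n" for j x
    using K_pos[OF ab(2) _ assms(9)[OF that(1)] that(2)] \<open>M0 > 0\<close> h0 h by simp
  have wpos: "0 < w x" if "x \<in> mesh a b n" for x
    using K_pos[OF ab(2) less_le_trans[OF _ E] w that] by simp
  have Tpos: "0 < T j x" if "j \<in> {1..N}" "x \<in> mesh a b n" for j x
    unfolding T_def
    using beta_hat_pos[where \<theta> = "\<theta> j" and \<beta> = "\<beta> j", OF ab h0(2) C[OF that(1)] that(2) \<theta>[OF that] \<beta>[OF that]]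
      interp_pos[where w = w, OF ab \<theta>[OF that] wpos]
    by simp
  \<comment> \<open>Only the distance of \<open>x\<close> and \<open>y\<close> matters, not their
    order, so both inequalities defining the cone follow from this one.\<close>
  have Tratio: "T j x \<le> T j y * exp ((M - \<delta>) * h)"
    if j: "j \<in> {1..N}" and x: "x \<in> mesh a b n" and y: "y \<in> mesh a b n" and xy: "\<bar>x - y\<bar> = h"
      and le: "\<beta> j x \<le> \<beta> j y * exp (M0 * step a b n)" for j x y
  proof -
    have "\<bar>\<theta> j x - \<theta> j y\<bar> \<le> c * step a b n"
      using lipschitz_onD[OF assms(7)[OF j] subsetD[OF mesh_subset[OF ab] x]
          subsetD[OF mesh_subset[OF ab] y]] xy h
      by (simp add: dist_real_def)
    from interp_ratio[OF ab \<open>c < 1\<close> E w \<theta>[OF j x] \<theta>[OF j y] this]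
    have "interp a b n w (\<theta> j x) \<le> exp (M * h) * ((1 + c) / 2) * interp a b n w (\<theta> j y)"
      using h by simp
    \<comment> \<open>The contraction gain \<open>(1 + c) / 2\<close> is traded for an exponential
      that pays for the weight, \<open>exp (M1 * h)\<close>, and leaves
      \<open>exp (- \<delta> * h)\<close> over.\<close>
    also have "\<dots> \<le> exp (M * h) * exp (- M2 * h) * interp a b n w (\<theta> j y)"
      using assms(17) interp_pos[where w = w, OF ab \<theta>[OF j y] wpos] by (intro mult_right_mono mult_left_mono) auto
    finally have I: "interp a b n w (\<theta> j x) \<le> exp (M * h) * exp (- M2 * h) * interp a b n w (\<theta> j y)" .
    have B: "beta_hat a b n (\<theta> j) (\<beta> j) (C j) s x
      \<le> exp (M1 * h) * beta_hat a b n (\<theta> j) (\<beta> j) (C j) s y"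
      using beta_hat_ratio[where \<theta> = "\<theta> j" and \<beta> = "\<beta> j", OF ab h0(2) C[OF j] \<open>s \<ge> 0\<close> x y
          \<theta>[OF j x] \<theta>[OF j y] \<beta>[OF j x] \<beta>[OF j y] le]
        \<open>M1 = s * M0 + (1 + h) / 2\<close> h by simp
    have "T j x \<le> (exp (M1 * h) * beta_hat a b n (\<theta> j) (\<beta> j) (C j) s y)
        * (exp (M * h) * exp (- M2 * h) * interp a b n w (\<theta> j y))"
      unfolding T_def
      using beta_hat_pos[where \<theta> = "\<theta> j" and \<beta> = "\<beta> j", OF ab h0(2) C[OF j] y \<theta>[OF j y] \<beta>[OF j y]]
        interp_pos[where w = w, OF ab \<theta>[OF j x] wpos]
      by (intro mult_mono[OF B I]) (simp_all add: less_imp_le)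
    also have "\<dots> = T j y * (exp (M1 * h) * exp (M * h) * exp (- M2 * h))"
      by (simp add: T_def)
    also have "exp (M1 * h) * exp (M * h) * exp (- M2 * h) = exp ((M - \<delta>) * h)"
      using \<open>M2 = M1 + \<delta>\<close> by (simp add: exp_add[symmetric] algebra_simps)
    finally show ?thesis .
  qed
  have Lpos: "0 < ?L x" if "x \<in> mesh a b n" for x
    unfolding L_node[OF that] T_def[symmetric]
    using Tpos that \<open>N \<ge> 1\<close> by (intro sum_pos) auto
  \<comment> \<open>The factor does not depend on \<open>j\<close>, so the termwise bounds add
    up.\<close>
  have Lratio: "?L x \<le> ?L y * exp ((M - \<delta>) * step a b n)"
    if "x \<in> mesh a b n" "y \<in> mesh a b n" "\<bar>x - y\<bar> = h"
      "\<And>j. j \<in> {1..N} \<Longrightarrow> \<beta> j x \<le> \<beta> j y * exp (M0 * step a b n)" for x y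
    unfolding L_node[OF that(1)] L_node[OF that(2)] T_def[symmetric] sum_distrib_right
    using Tratio that h by (intro sum_mono) auto
  have "?L (node a b n (k + 1)) \<le> ?L (node a b n k) * exp ((M - \<delta>) * step a b n) \<and>
      ?L (node a b n k) \<le> ?L (node a b n (k + 1)) * exp ((M - \<delta>) * step a b n)" if "k < n" for k
    using K_stepD[of "\<beta> j" a b n M0 k for j] assms(9) that h h0
      node_in_mesh[of k n a b] node_in_mesh[of "k + 1" n a b]
    by (intro conjI Lratio) (auto simp: node_Suc)
  moreover have "?L \<in> X a b n" by (simp add: L_def X_def)
  ultimately have "?L \<in> K a b n (M - \<delta>)" by (simp add: K_def)
  moreover have "?L \<noteq> zero_X a b n"
    using Lpos[OF node_in_mesh[of 0 n a b]] node_in_mesh[of 0 n a b] by (auto simp: zero_X_def)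
  ultimately show "?L \<in> K a b n (M - \<delta>) - {zero_X a b n}" by simp
qed

end
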